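(* Let $0<\rho<1/2$, let $\eta_0\in X_\rho$, and let $\eta_t$, $h_t$ ($t=0,1,2,\dots$) be the corresponding evolving F-TASEP configuration and height profile. Let $P_t=\{p\in\mathbb Z: h_t(p)>\sup_{i<p}h_t(i)\}$. Then: (a) $P_t$ is independent of $t$; write $P=P_t$. (b) For each $i\in\mathbb Z$, $\eta_t(i)$ and $h_t(i)$ are nondecreasing in $t$ and eventually constant. If these limiting values are denoted $\eta_\infty(i)$ and $h_\infty(i)$, then for any two consecutive points $p<p'$ of $P$ there is an integer $n\ge0$ such that the string $\eta_\infty(p+1)\,\eta_\infty(p+2)\cdots\eta_\infty(p')$ equals $(1\,0)^n\,0$.
   Context: $X=\{0,1\}^{\mathbb Z}$ ($1$ = particle, $0$ = hole). The F-TASEP is the facilitated totally asymmetric simple exclusion process, with step $U:X\to X$: simultaneously, every particle at a site $j$ with $\eta(j-1)=1$ and $\eta(j+1)=0$ moves to $j+1$; $\eta_{t+1}=U\eta_t$. $X_\rho$ is the set of $\eta\in X$ with $\lim_{N\to\infty}\frac1N\sum_{i=1}^N\eta(i)=\lim_{N\to\infty}\frac1N\sum_{i=-N}^{-1}\eta(i)=\rho$. Height profiles $h_t:\mathbb Z\to\mathbb Z$: $h_0(0)=0$ and $h_0(k)-h_0(k-1)=(-1)^{\eta_0(k)}$ for all $k$; and $h_{t+1}(k)=h_t(k)+2$ if $\eta_t(k-1)=\eta_t(k)=1$ and $\eta_t(k+1)=0$, $h_{t+1}(k)=h_t(k)$ otherwise. Then $h_t(k)-h_t(k-1)=(-1)^{\eta_t(k)}$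 for all $t,k$. Since $\rho<1/2$, $h_t(i)\to\pm\infty$ as $i\to\pm\infty$ and $P_t$ is unbounded above and below. $(1\,0)^n0$ denotes $n$ copies of the string $10$ followed by $0$.
   Formalization: The claim that η_t(i) is nondecreasing in t is dropped, being false (a particle jumping from i changes η(i) from 1 to 0, as in 110→101); only h_t(i) is stated to be nondecreasing, while both η_t(i) and h_t(i) are shown eventually constant. *)

theory Defs
  imports Complex_Main "HOL-Library.Extended_Real"
begin

type_synonym config = "int \<Rightarrow> nat"

definition configs :: "config set" where
  "configs = {\<eta>. \<forall>i. \<eta> i \<in> {0, 1}}"

definition configs_density :: "real \<Rightarrow> config set" where
  "configs_density \<rho> = {\<eta> \<in> configs.
     (\<lambda>N::nat. (1 / real N) * (\<Sum>i = 1..int N. real (\<eta> i))) \<longlonglongrightarrow> \<rho> \<and>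
     (\<lambda>N::nat. (1 / real N) * (\<Sum>i = - int N..-1. real (\<eta> i))) \<longlonglongrightarrow> \<rho>}"

definition jumps :: "config \<Rightarrow> int \<Rightarrow> bool" where
  "jumps \<eta> j \<longleftrightarrow> \<eta> (j - 1) = 1 \<and> \<eta> j = 1 \<and> \<eta> (j + 1) = 0"

text \<open>
  The two cases below exclude each other: a jump from \<open>i\<close> needs \<open>\<eta> i = 1\<close>, a jump from
  \<open>i - 1\<close> needs \<open>\<eta> i = 0\<close>.
\<close>

definition ftasep_step :: "config \<Rightarrow> config" where
  "ftasep_step \<eta> = (\<lambda>i. if jumps \<eta> i then 0 else if jumps \<eta> (i - 1) then 1 else \<eta> i)"

definition ftasep_evolution :: "(nat \<Rightarrow> config) \<Rightarrow> bool" where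
  "ftasep_evolution \<eta> \<longleftrightarrow> (\<forall>t. \<eta> (Suc t) = ftasep_step (\<eta> t))"

definition height_evolution :: "(nat \<Rightarrow> config) \<Rightarrow> (nat \<Rightarrow> int \<Rightarrow> int) \<Rightarrow> bool" where
  "height_evolution \<eta> h \<longleftrightarrow>
     h 0 0 = 0 \<and>
     (\<forall>k. h 0 k - h 0 (k - 1) = (- 1) ^ \<eta> 0 k) \<and>
     (\<forall>t k. h (Suc t) k =
        (if \<eta> t (k - 1) = 1 \<and> \<eta> t k = 1 \<and> \<eta> t (k + 1) = 0 then h t k + 2 else h t k))"

text \<open>
  The supremum is taken in the extended reals, so that it is \<open>\<infinity>\<close> when the heights to the left
  of \<open>p\<close> are unbounded above (the supremum on \<^typ>\<open>int\<close> would then be an unspecified value).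
\<close>

definition record_points :: "(int \<Rightarrow> int) \<Rightarrow> int set" where
  "record_points h =
     {p. ereal (of_int (h p)) > (SUP i \<in> {..<p}. ereal (of_int (h i)))}"

definition consecutive_in :: "int set \<Rightarrow> int \<Rightarrow> int \<Rightarrow> bool" where
  "consecutive_in P p p' \<longleftrightarrow>
     p \<in> P \<and> p' \<in> P \<and> p < p' \<and> (\<forall>q\<in>P. \<not> (p < q \<and> q < p'))"

lemma height_evolution_exists: "\<exists>h. height_evolution \<eta> h"
proof -
  define h0 where "h0 k = (\<Sum>i = 1..k. (- 1) ^ \<eta> 0 i) - (\<Sum>i = k + 1..0. (- 1::int) ^ \<eta> 0 i)"
    for k
  define h where "h = rec_nat h0 (\<lambda>t g k. if \<eta> t (k - 1) = 1 \<and> \<eta> t k = 1 \<and> \<eta> t (k + 1) = 0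
    then g k + 2 else g k)"
  have "h0 k - h0 (k - 1) = (- 1) ^ \<eta> 0 k" for k
  proof (cases "k \<ge> 1")
    case True
    then have "{1..k} = insert k {1..k - 1}" by auto
    then show ?thesis using True by (simp add: h0_def)
  next
    case False
    then have "{k..0} = insert k {k + 1..0}" by auto
    then show ?thesis using False by (simp add: h0_def)
  qed
  then have "height_evolution \<eta> h"
    by (simp add: height_evolution_def h_def h0_def)
  then show ?thesis by blast
qed

end

(*
  A jump from k lifts h(k) from h(k - 2) - 2 to exactly h(k - 2).  Hence a step neither changes any
  running maximum of the profile nor moves a record point, which gives (a).  As the density is below
  1/2, there are record points arbitrarily far to the right; their constant heights bound the
  nondecreasing integers h_t(i), so everything freezes.  In the frozen configuration the pattern 110
  cannot occur, since it would still jump.  Between consecutive record points p < p' the frozen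
  profile stays at or below its height at p, so from p it can only repeat the excursion 10 until it
  takes the final step up to p'.
*)
theory Submission
  imports Defs
begin

section \<open>Height profiles under one step of the dynamics\<close>

definition profile_of :: "config \<Rightarrow> (int \<Rightarrow> int) \<Rightarrow> bool" where
  "profile_of \<eta> h \<longleftrightarrow> \<eta> \<in> configs \<and> (\<forall>k. h k - h (k - 1) = (- 1) ^ \<eta> k)"

definition height_step :: "config \<Rightarrow> (int \<Rightarrow> int) \<Rightarrow> int \<Rightarrow> int" where
  "height_step \<eta> h k = (if jumps \<eta> k then h k + 2 else h k)"

lemma configs_cases:
  assumes "\<eta> \<in> configs"
  shows "\<eta> k = 0 \<or> \<eta> k = 1"
  using assms by (simp add: configs_def)

lemma profile_of_cases:
  assumes "profile_of \<eta> h"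
  shows "\<eta> k = 0 \<and> h k = h (k - 1) + 1 \<or> \<eta> k = 1 \<and> h k = h (k - 1) - 1"
proof -
  have "\<eta> k = 0 \<or> \<eta> k = 1" "h k - h (k - 1) = (- 1) ^ \<eta> k"
    using assms configs_cases by (auto simp: profile_of_def)
  then show ?thesis by auto
qed

text \<open>A jump from \<open>k\<close> turns the increments -1, +1 at \<open>k\<close> and
  \<open>k + 1\<close> into +1, -1, which amounts to raising the single height at \<open>k\<close>
  by 2.\<close>

lemma profile_of_step:
  assumes "profile_of \<eta> h"
  shows "profile_of (ftasep_step \<eta>) (height_step \<eta> h)"
proof -
  have "ftasep_step \<eta> \<in> configs"
    using assms by (simp add: profile_of_def configs_def ftasep_step_def)
  moreover have "height_step \<eta> h k - height_step \<eta> h (k - 1) = (- 1) ^ ftasep_step \<eta> k" for k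
    using profile_of_cases[OF assms, of k]
    by (auto simp: height_step_def ftasep_step_def jumps_def)
  ultimately show ?thesis by (simp add: profile_of_def)
qed

lemma height_step_ge: "h k \<le> height_step \<eta> h k"
  by (simp add: height_step_def)

text \<open>The particles at \<open>k - 1\<close> and \<open>k\<close> are two down steps, which the
  rise by 2 undoes. With a hole at \<open>k - 1\<close> such a rise would overshoot
  \<open>h (k - 2)\<close>; facilitation is what keeps maxima from growing.\<close>

lemma height_step_eq_shift:
  assumes "profile_of \<eta> h" "jumps \<eta> k"
  shows "height_step \<eta> h k = h (k - 2)"
  using assms profile_of_cases[OF assms(1), of k] profile_of_cases[OF assms(1), of "k - 1"]
  by (auto simp: height_step_def jumps_def)

section \<open>Record points and their invariance\<close>

lemma record_points_iff: "p \<in> record_points h \<longleftrightarrow> (\<forall>i<p. h i < h p)"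
proof
  assume "p \<in> record_points h"
  then have less: "(SUP i \<in> {..<p}. ereal (of_int (h i))) < ereal (of_int (h p))"
    by (simp add: record_points_def)
  show "\<forall>i<p. h i < h p"
  proof (intro allI impI)
    fix i assume "i < p"
    then have "ereal (of_int (h i)) \<le> (SUP i \<in> {..<p}. ereal (of_int (h i)))"
      by (intro SUP_upper) simp
    then have "ereal (of_int (h i)) < ereal (of_int (h p))"
      using less by (rule le_less_trans)
    then show "h i < h p" by simp
  qed
next
  assume rec: "\<forall>i<p. h i < h p"
  \<comment> \<open>Integrality leaves a gap of 1, so strictness survives the supremum over
    infinitely many sites.\<close>
  have "(SUP i \<in> {..<p}. ereal (of_int (h i))) \<le> ereal (of_int (h p - 1))"
  proof (rule SUP_least)
    fix i assume "i \<in> {..<p}"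
    then have "h i \<le> h p - 1" using rec by force
    then show "ereal (of_int (h i)) \<le> ereal (of_int (h p - 1))"
      by (simp only: ereal_less_eq of_int_le_iff)
  qed
  also have "\<dots> < ereal (of_int (h p))" by simp
  finally show "p \<in> record_points h" by (simp add: record_points_def)
qed

text \<open>A jump would set the height at \<open>p\<close> to \<open>h (p - 2)\<close>, below its
  record value, whereas steps never lower a height.\<close>

lemma height_step_record_point:
  assumes "profile_of \<eta> h" "p \<in> record_points h"
  shows "height_step \<eta> h p = h p"
proof -
  have "h (p - 2) < h p" using assms(2) by (simp add: record_points_iff)
  then have "\<not> jumps \<eta> p"
    using height_step_eq_shift[OF assms(1)] height_step_ge[of h p \<eta>] by fastforce
  then show ?thesis by (simp add: height_step_def)
qed

lemma record_points_step:
  assumes "profile_of \<eta> h"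
  shows "record_points (height_step \<eta> h) = record_points h"
proof (intro set_eqI iffI)
  fix p assume p: "p \<in> record_points (height_step \<eta> h)"
  \<comment> \<open>After a jump from \<open>p\<close> its height would not exceed the new height at
    \<open>p - 2\<close>, so \<open>p\<close> would be no record.\<close>
  have "\<not> jumps \<eta> p"
  proof
    assume "jumps \<eta> p"
    then have "height_step \<eta> h p \<le> height_step \<eta> h (p - 2)"
      using height_step_eq_shift[OF assms] height_step_ge by simp
    moreover have "height_step \<eta> h (p - 2) < height_step \<eta> h p"
      using p by (simp add: record_points_iff)
    ultimately show False by simp
  qed
  then have "height_step \<eta> h p = h p" by (simp add: height_step_def)
  then show "p \<in> record_points h"
    using p height_step_ge[of h _ \<eta>] by (fastforce simp: record_points_iff intro: le_less_trans)
next
  fix p assume p: "p \<in> record_points h"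
  \<comment> \<open>A raised site only takes over the old height at \<open>i - 2\<close>, which also
    lies left of the record \<open>p\<close>.\<close>
  have "height_step \<eta> h i < h p" if "i < p" for i
  proof (cases "jumps \<eta> i")
    case True
    then show ?thesis
      using p that height_step_eq_shift[OF assms] by (simp add: record_points_iff)
  next
    case False
    then show ?thesis using p that by (simp add: record_points_iff height_step_def)
  qed
  then show "p \<in> record_points (height_step \<eta> h)"
    using height_step_record_point[OF assms p] by (simp add: record_points_iff)
qed

text \<open>The first site where the profile exceeds \<open>M\<close> is a record. This serves both
  to find records far to the right and to exclude high points between consecutive records.\<close>

lemma record_pointI_first_passage:
  fixes h :: "int \<Rightarrow> int"
  assumes "\<forall>i\<le>a. h i \<le> M" "a < b" "M < h b"
  obtains p where "a < p" "p \<le> b" "M < h p" "p \<in> record_points h"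
proof -
  define n where "n = (LEAST n. M < h (a + int n))"
  have "M < h (a + int (nat (b - a)))" using assms by simp
  then have n: "M < h (a + int n)" "n \<le> nat (b - a)"
    unfolding n_def by (rule LeastI, rule Least_le)
  have below: "h i \<le> M" if "i < a + int n" for i
  proof (cases "i \<le> a")
    case False
    then have "i = a + int (nat (i - a))" "nat (i - a) < n" using that by auto
    then show ?thesis using not_less_Least[of "nat (i - a)"] unfolding n_def
      by (metis not_less)
  qed (use assms in auto)
  have "n \<noteq> 0" using n assms(1) by (metis add.right_neutral not_less of_nat_0 order_refl)
  show thesis
  proof
    show "a + int n \<in> record_points h"
      using n(1) below by (force simp: record_points_iff)
  qed (use n \<open>n \<noteq> 0\<close> \<open>a < b\<close> in auto)
qed

section \<open>Particle density and growth of the profile\<close>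

lemma profile_of_right:
  assumes "profile_of \<eta> h"
  shows "h (int N) = h 0 + int N - 2 * (\<Sum>i = 1..int N. int (\<eta> i))"
proof (induction N)
  case (Suc N)
  have "{1..int (Suc N)} = insert (int (Suc N)) {1..int N}" by auto
  then show ?case using Suc profile_of_cases[OF assms, of "int (Suc N)"] by auto
qed simp

text \<open>The increment at site \<open>k\<close> joins \<open>k - 1\<close> to \<open>k\<close>,
  so the sites from \<open>- N\<close> to \<open>- 1\<close> lead from \<open>- N - 1\<close> to
  \<open>- 1\<close>; hence the base point \<open>- 1\<close> instead of 0.\<close>

lemma profile_of_left:
  assumes "profile_of \<eta> h"
  shows "h (- int N - 1) = h (- 1) - int N + 2 * (\<Sum>i = - int N..-1. int (\<eta> i))"
proof (induction N)
  case (Suc N)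
  have "{- int (Suc N)..-1} = insert (- int N - 1) {- int N..-1}" by auto
  then show ?case using Suc profile_of_cases[OF assms, of "- int N - 1"] by auto
qed simp

lemma eventually_sum_less:
  fixes s :: "nat \<Rightarrow> int" and r :: real
  assumes "(\<lambda>N. (1 / real N) * of_int (s N)) \<longlonglongrightarrow> \<rho>" "\<rho> < r"
  shows "\<forall>\<^sub>F N in sequentially. of_int (s N) < r * real N"
  using order_tendstoD(2)[OF assms] eventually_gt_at_top[of 0]
  by eventually_elim (simp add: field_simps)

lemma profile_unbounded_right:
  assumes "profile_of \<eta> h" "\<eta> \<in> configs_density \<rho>" "\<rho> < 1 / 2"
  shows "\<exists>b>a. M < h b"
proof -
  \<comment> \<open>The midpoint of \<open>\<rho>\<close> and 1/2 leaves a positive slope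
    \<open>1 - 2 * r\<close>, which eventually beats any constant.\<close>
  define r where "r = (\<rho> + 1 / 2) / 2"
  have r: "\<rho> < r" "0 < 1 - 2 * r" using assms(3) by (auto simp: r_def field_simps)
  have "(\<lambda>N. (1 / real N) * of_int (\<Sum>i = 1..int N. int (\<eta> i))) \<longlonglongrightarrow> \<rho>"
    using assms(2) by (simp add: configs_density_def)
  from eventually_sum_less[OF this r(1)]
  have "\<forall>\<^sub>F N in sequentially. of_int (\<Sum>i = 1..int N. int (\<eta> i)) < r * real N" .
  moreover have "\<forall>\<^sub>F N in sequentially. (of_int (M - h 0) / (1 - 2 * r)) < real N"
    using filterlim_real_sequentially filterlim_at_top_dense by blast
  ultimately have "\<forall>\<^sub>F N in sequentially. nat a < N \<and> M < h (int N)"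
    using eventually_gt_at_top[of "nat a"]
  proof eventually_elim
    case (elim N)
    then have "of_int (M - h 0) < (1 - 2 * r) * real N"
      using r by (simp add: field_simps)
    also have "\<dots> < real N - 2 * of_int (\<Sum>i = 1..int N. int (\<eta> i))"
      using elim(1) by (simp add: algebra_simps)
    also have "\<dots> = of_int (h (int N) - h 0)"
      using profile_of_right[OF assms(1), of N] by simp
    finally show ?case using elim by (simp only: of_int_less_iff) simp
  qed
  then obtain N where "nat a < N" "M < h (int N)"
    using eventually_happens by force
  then show ?thesis by (intro exI[of _ "int N"]) auto
qed

text \<open>Far to the left fewer than half of the sites up to \<open>- 1\<close> are occupied, so
  the profile is at most \<open>h (- 1)\<close> there; finitely many sites up to \<open>a\<close>
  remain.\<close>

lemma profile_bounded_left:
  assumes "profile_of \<eta> h" "\<eta> \<in> configs_density \<rho>" "\<rho> < 1 / 2"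
  obtains M where "\<forall>i\<le>a. h i \<le> M"
proof -
  have "(\<lambda>N. (1 / real N) * of_int (\<Sum>i = - int N..-1. int (\<eta> i))) \<longlonglongrightarrow> \<rho>"
    using assms(2) by (simp add: configs_density_def)
  from eventually_sum_less[OF this assms(3)]
  obtain N0 where N0: "of_int (\<Sum>i = - int N..-1. int (\<eta> i)) < 1 / 2 * real N" if "N0 \<le> N" for N
    by (auto simp: eventually_sequentially)
  have left: "h i \<le> h (- 1)" if "i \<le> - int N0 - 1" for i
  proof -
    define N where "N = nat (- i - 1)"
    have N: "i = - int N - 1" "N0 \<le> N" using that by (auto simp: N_def)
    have "real_of_int (2 * (\<Sum>i = - int N..-1. int (\<eta> i))) < real_of_int (int N)"
      using N0[OF N(2)] by simp
    then have "2 * (\<Sum>i = - int N..-1. int (\<eta> i)) < int N"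
      by (simp only: of_int_less_iff)
    then show ?thesis using profile_of_left[OF assms(1), of N] N(1) by simp
  qed
  show thesis
  proof
    show "\<forall>i\<le>a. h i \<le> Max (insert (h (- 1)) (h ` {- int N0 - 1..a}))"
    proof (intro allI impI)
      fix i assume "i \<le> a"
      show "h i \<le> Max (insert (h (- 1)) (h ` {- int N0 - 1..a}))"
      proof (cases "i \<le> - int N0 - 1")
        case True
        then show ?thesis by (rule order_trans[OF left Max_ge]) simp_all
      next
        case False
        then show ?thesis using \<open>i \<le> a\<close> by (intro Max_ge) auto
      qed
    qed
  qed
qed

lemma record_points_unbounded:
  assumes "profile_of \<eta> h" "\<eta> \<in> configs_density \<rho>" "\<rho> < 1 / 2"
  shows "\<exists>p>a. p \<in> record_points h"
proof -
  obtain M where M: "\<forall>i\<le>a. h i \<le> M" using profile_bounded_left[OF assms] .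
  obtain b where "a < b" "M < h b" using profile_unbounded_right[OF assms] by blast
  then show ?thesis using record_pointI_first_passage[OF M] by metis
qed

section \<open>Bounded integer sequences and frozen configurations\<close>

lemma incseq_int_bounded_eventually_const:
  fixes f :: "nat \<Rightarrow> int"
  assumes "mono f" "\<And>t. f t \<le> B"
  shows "\<exists>c. \<forall>\<^sub>F t in sequentially. f t = c"
proof -
  have "range f \<subseteq> {f 0..B}" using assms by (auto dest: monoD[of f 0])
  then have fin: "finite (range f)" by (rule finite_subset) simp
  have "Max (range f) \<in> range f" by (rule Max_in[OF fin]) simp
  then obtain T where T: "f T = Max (range f)" by force
  have "f t = f T" if "T \<le> t" for t
    using that monoD[OF assms(1) that] Max_ge[OF fin, of "f t"] T by simp
  then show ?thesis by (auto simp: eventually_sequentially)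
qed

text \<open>A hole right after two adjacent particles would allow a jump, so the pair propagates to
  the right forever.\<close>

lemma ones_to_the_right:
  assumes "\<eta> \<in> configs" "\<And>k. \<not> jumps \<eta> k" "\<eta> k = 1" "\<eta> (k + 1) = 1"
  shows "\<eta> (k + int n) = 1"
proof -
  have "\<eta> (k + int n) = 1 \<and> \<eta> (k + int n + 1) = 1"
  proof (induction n)
    case (Suc n)
    then have "\<eta> (k + int n + 2) \<noteq> 0"
      using assms(2)[of "k + int n + 1"] by (auto simp: jumps_def algebra_simps)
    then show ?case
      using Suc configs_cases[OF assms(1), of "k + int n + 2"] by (auto simp: algebra_simps)
  qed (use assms in auto)
  then show ?thesis ..
qed

text \<open>The site \<open>q\<close> runs through visits to the level \<open>h p\<close>; the
  induction strips one block 10 per visit.\<close>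

lemma frozen_excursion:
  assumes prof: "profile_of \<eta> h" and frozen: "\<And>k. \<not> jumps \<eta> k"
    and below: "\<And>q. p \<le> q \<Longrightarrow> q < p' \<Longrightarrow> h q \<le> h p"
    and above: "h p < h p'"
    and "p \<le> q" "q < p'" "h q = h p"
  shows "\<exists>n. map \<eta> [q + 1..p'] = concat (replicate n [1, 0]) @ [0]"
  using assms(5-7)
proof (induction "nat (p' - q)" arbitrary: q rule: less_induct)
  case less
  note cases = profile_of_cases[OF prof]
  show ?case
  proof (cases "\<eta> (q + 1) = 0")
    case True
    then have "h (q + 1) = h p + 1" using cases[of "q + 1"] less.prems by auto
    \<comment> \<open>Rising above the level \<open>h p\<close> is possible only on arrival at
      \<open>p'\<close>.\<close>
    then have "\<not> q + 1 < p'" using below[of "q + 1"] less.prems by auto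
    then have "p' = q + 1" using less.prems by simp
    then show ?thesis using True by (intro exI[of _ 0]) simp
  next
    case False
    then have q1: "\<eta> (q + 1) = 1" "h (q + 1) = h p - 1"
      using cases[of "q + 1"] less.prems by auto
    then have "q + 1 < p'" using above less.prems by (cases "q + 1 = p'") auto
    have "\<eta> p' = 0"
      using cases[of p'] above below[of "p' - 1"] less.prems by auto
    \<comment> \<open>Otherwise two adjacent ones would propagate up to \<open>p'\<close>, which is
      a hole.\<close>
    have "\<eta> (q + 2) = 0"
    proof (rule ccontr)
      assume "\<eta> (q + 2) \<noteq> 0"
      then have "\<eta> (q + 1 + 1) = 1" using cases[of "q + 2"] by (auto simp: algebra_simps)
      then have "\<eta> (q + 1 + int (nat (p' - q - 1))) = 1"
        using ones_to_the_right q1 prof frozen unfolding profile_of_def by blast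
      then show False using \<open>q + 1 < p'\<close> \<open>\<eta> p' = 0\<close> by simp
    qed
    then have "h (q + 2) = h p" using cases[of "q + 2"] q1 by (auto simp: algebra_simps)
    then have "q + 2 < p'" using above \<open>q + 1 < p'\<close> by (cases "q + 2 = p'") auto
    have "\<exists>n. map \<eta> [q + 2 + 1..p'] = concat (replicate n [1, 0]) @ [0]"
      using \<open>q + 2 < p'\<close> \<open>h (q + 2) = h p\<close> less.prems by (intro less.hyps) auto
    then obtain n where "map \<eta> [q + 2 + 1..p'] = concat (replicate n [1, 0]) @ [0]" ..
    moreover have "[q + 1..p'] = (q + 1) # (q + 2) # [q + 2 + 1..p']"
      using upto_rec1[of "q + 1" p'] upto_rec1[of "q + 2" p'] \<open>q + 2 < p'\<close>
      by (simp add: add.assoc)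
    ultimately have "map \<eta> [q + 1..p'] = concat (replicate (Suc n) [1, 0]) @ [0]"
      using q1 \<open>\<eta> (q + 2) = 0\<close> by simp
    then show ?thesis ..
  qed
qed

lemma frozen_between_records:
  assumes "profile_of \<eta> h" "\<And>k. \<not> jumps \<eta> k" "consecutive_in (record_points h) p p'"
  shows "\<exists>n. map \<eta> [p + 1..p'] = concat (replicate n [1, 0]) @ [0]"
proof (rule frozen_excursion[OF assms(1,2)])
  have p: "p \<in> record_points h" and p': "p' \<in> record_points h" and "p < p'"
    and none: "\<And>q. q \<in> record_points h \<Longrightarrow> \<not> (p < q \<and> q < p')"
    using assms(3) by (auto simp: consecutive_in_def)
  then show "h p < h p'" "p \<le> p" "p < p'" "h p = h p"
    by (auto simp: record_points_iff)
  have le: "\<forall>i\<le>p. h i \<le> h p"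
    using p by (auto simp: record_points_iff order_le_less)
  show "h q \<le> h p" if "p \<le> q" "q < p'" for q
  proof (rule ccontr)
    assume "\<not> h q \<le> h p"
    then have "p < q" "h p < h q" using that by (auto simp: order_le_less)
    then obtain r where "p < r" "r \<le> q" "r \<in> record_points h"
      using record_pointI_first_passage[OF le] by metis
    then show False using none that by force
  qed
qed

theorem theorem3p1:
  fixes \<rho> :: real and \<eta> :: "nat \<Rightarrow> config" and h :: "nat \<Rightarrow> int \<Rightarrow> int"
  assumes "0 < \<rho>" and "\<rho> < 1 / 2"
    and "\<eta> 0 \<in> configs_density \<rho>"
    and "ftasep_evolution \<eta>"
    and "height_evolution \<eta> h"
  shows "\<exists>P. (\<forall>t. record_points (h t) = P) \<and>
    (\<forall>i. mono (\<lambda>t. h t i)) \<and>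
    (\<exists>\<eta>_inf h_inf.
       (\<forall>i. \<forall>\<^sub>F t in sequentially. \<eta> t i = \<eta>_inf i) \<and>
       (\<forall>i. \<forall>\<^sub>F t in sequentially. h t i = h_inf i) \<and>
       (\<forall>p p'. consecutive_in P p p' \<longrightarrow>
          (\<exists>n::nat. map \<eta>_inf [p + 1..p'] = concat (replicate n [1, 0]) @ [0])))"
proof -
  define P where "P = record_points (h 0)"
  have \<eta>_Suc: "\<eta> (Suc t) = ftasep_step (\<eta> t)" for t
    using assms(4) by (simp add: ftasep_evolution_def)
  have h_Suc: "h (Suc t) = height_step (\<eta> t) (h t)" for t
    using assms(5) by (auto simp: height_evolution_def height_step_def jumps_def)
  have prof: "profile_of (\<eta> t) (h t)" for t
  proof (induction t)
    case 0
    then show ?case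
      using assms(3,5) by (simp add: profile_of_def configs_density_def height_evolution_def)
  next
    case (Suc t)
    then show ?case by (simp add: \<eta>_Suc h_Suc profile_of_step)
  qed
  have rec: "record_points (h t) = P" for t
    by (induction t) (simp_all add: P_def h_Suc record_points_step[OF prof])
  have mono: "mono (\<lambda>t. h t i)" for i
    unfolding mono_iff_le_Suc by (simp add: h_Suc height_step_ge)
  have const: "h t p = h 0 p" if "p \<in> P" for p t
    by (induction t) (use that in \<open>simp_all add: h_Suc height_step_record_point[OF prof] rec\<close>)
  have "\<exists>c. \<forall>\<^sub>F t in sequentially. h t i = c" for i
  proof -
    obtain p where p: "i < p" "p \<in> P"
      using record_points_unbounded[OF prof assms(3,2)] unfolding P_def by blast
    then have "h t i \<le> h 0 p" for t
      using rec[of t] const[of p t] by (force simp: record_points_iff)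
    then show ?thesis by (rule incseq_int_bounded_eventually_const[OF mono])
  qed
  then obtain h_inf where h_inf: "\<And>i. \<forall>\<^sub>F t in sequentially. h t i = h_inf i"
    by metis
  define \<eta>_inf :: config where "\<eta>_inf k = (if h_inf k = h_inf (k - 1) + 1 then 0 else 1)" for k
  have \<eta>_inf: "\<forall>\<^sub>F t in sequentially. \<eta> t k = \<eta>_inf k" for k
    using h_inf[of k] h_inf[of "k - 1"]
  proof eventually_elim
    case (elim t)
    then show ?case using profile_of_cases[OF prof, of t k] by (auto simp: \<eta>_inf_def)
  qed
  have prof_inf: "profile_of \<eta>_inf h_inf"
  proof -
    have "\<eta>_inf \<in> configs" by (simp add: configs_def \<eta>_inf_def)
    moreover have "h_inf k - h_inf (k - 1) = (- 1) ^ \<eta>_inf k" for k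
    proof -
      have "\<forall>\<^sub>F t in sequentially. h_inf k - h_inf (k - 1) = (- 1) ^ \<eta>_inf k"
        using h_inf[of k] h_inf[of "k - 1"] \<eta>_inf[of k]
      proof eventually_elim
        case (elim t)
        have "h t k - h t (k - 1) = (- 1) ^ \<eta> t k"
          using prof[of t] by (simp add: profile_of_def)
        then show ?case by (simp only: elim)
      qed
      then show ?thesis by simp
    qed
    ultimately show ?thesis by (simp add: profile_of_def)
  qed
  have frozen: "\<not> jumps \<eta>_inf k" for k
  proof -
    have "\<forall>\<^sub>F t in sequentially. h (Suc t) k = h_inf k"
      using h_inf[of k] by (simp only: eventually_sequentially_Suc[of "\<lambda>t. h t k = h_inf k"])
    then have "\<forall>\<^sub>F t in sequentially. \<not> jumps \<eta>_inf k"
      using h_inf[of k] \<eta>_inf[of "k - 1"] \<eta>_inf[of k] \<eta>_inf[of "k + 1"]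
    proof eventually_elim
      case (elim t)
      then show ?case using h_Suc[of t] by (auto simp: height_step_def jumps_def split: if_splits)
    qed
    then show ?thesis by simp
  qed
  have le_inf: "h t i \<le> h_inf i" for t i
  proof -
    have "\<forall>\<^sub>F s in sequentially. h t i \<le> h_inf i"
      using h_inf[of i] eventually_ge_at_top[of t]
      by eventually_elim (use monoD[OF mono] in metis)
    then show ?thesis by simp
  qed
  have rec_inf: "record_points h_inf = P"
  proof (intro set_eqI iffI)
    fix p assume p: "p \<in> P"
    have "h_inf i < h_inf p" if "i < p" for i
    proof -
      have "\<forall>\<^sub>F t in sequentially. h_inf i < h_inf p"
        using h_inf[of i] h_inf[of p]
      proof eventually_elim
        case (elim t)
        then show ?case using p that rec[of t] record_points_iff[of p "h t"] by metis
      qed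
      then show ?thesis by simp
    qed
    then show "p \<in> record_points h_inf" by (simp add: record_points_iff)
  next
    fix p assume p: "p \<in> record_points h_inf"
    obtain t where t: "h t p = h_inf p"
      using eventually_happens[OF h_inf[of p]] by auto
    have "h t i < h t p" if "i < p" for i
      using p that le_inf[of t i] t by (force simp: record_points_iff)
    then show "p \<in> P" using rec[of t] by (auto simp: record_points_iff)
  qed
  have "\<exists>n. map \<eta>_inf [p + 1..p'] = concat (replicate n [1, 0]) @ [0]"
    if "consecutive_in P p p'" for p p'
    using frozen_between_records[OF prof_inf frozen] that by (simp add: rec_inf)
  then show ?thesis using rec mono \<eta>_inf h_inf by blast
qed

end
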